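(* The number of isomorphism classes of tournaments on $n$ vertices is given by the expression \[ \frac{1}{n!} \sum_{\substack{g \in \mathrm{Sym}(n)\\ |g|\ \mathrm{odd}}} 2^{c(g_E)}. \]
   Context: Here $n$ is a positive integer, $[n]=\{1,2,\ldots,n\}$, $\mathrm{Sym}(n)$ is the symmetric group on $[n]$, and $|g|$ is the order of $g \in \mathrm{Sym}(n)$. The image of $u\in[n]$ under $g$ is written $u^g$. Let $E_n=\{\{u,v\} : u,v\in[n],\ u\neq v\}$ be the set of unordered pairs of distinct elements of $[n]$. For $g\in\mathrm{Sym}(n)$, $g_E$ denotes the permutation of $E_n$ induced by $g$, i.e. $\{u,v\}\mapsto\{u^g,v^g\}$, and $c(g_E)$ denotes the number of cycles of $g_E$ on $E_n$, where fixed points count as cycles of length 1. A tournament is a directed graph $D$ (without loops) with arc set $A(D)$ such that for any two distinct vertices $v,w$, either $(v,w)\in A(D)$ or $(w,v)\in A(D)$, but not both. *)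

theory Defs
  imports
    "HOL-Algebra.Multiplicative_Group"
    "HOL-Algebra.Sym_Groups"
    "HOL-Combinatorics.Orbits"
    "Graph_Theory.Pair_Digraph"
    "Graph_Theory.Digraph_Isomorphism"
begin

locale pair_tournament = pair_loopfree_digraph +
  assumes exactly_one_arc:
    "\<lbrakk>v \<in> pverts G; w \<in> pverts G; v \<noteq> w\<rbrakk> \<Longrightarrow> (v, w) \<in> parcs G \<longleftrightarrow> (w, v) \<notin> parcs G"

definition tournaments :: "nat \<Rightarrow> nat pair_pre_digraph set" where
  "tournaments n = {T. pair_tournament T \<and> pverts T = {1..n}}"

definition tournament_iso :: "nat \<Rightarrow> nat pair_pre_digraph rel" where
  "tournament_iso n =
     {(S, T). S \<in> tournaments n \<and> T \<in> tournaments n \<and> digraph_iso (with_proj S) (with_proj T)}"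

text \<open>Every tournament on \<open>n\<close> vertices is isomorphic to one with vertex set \<open>{1..n}\<close>, so the
  isomorphism classes are taken among the latter.\<close>

definition tournament_classes :: "nat \<Rightarrow> nat pair_pre_digraph set set" where
  "tournament_classes n = tournaments n // tournament_iso n"

lemma digraph_iso_with_proj_iff:
  assumes "wf_digraph (with_proj S)"
  shows "digraph_iso (with_proj S) (with_proj T) \<longleftrightarrow>
    (\<exists>f. bij_betw f (pverts S) (pverts T) \<and> parcs T = map_prod f f ` parcs S)"
proof
  assume "digraph_iso (with_proj S) (with_proj T)"
  then obtain h where h: "pre_digraph.digraph_isomorphism (with_proj S) h"
    and T: "with_proj T = app_iso h (with_proj S)"
    by (auto simp: digraph_iso_def)
  have "pverts T = iso_verts h ` pverts S"
    using arg_cong[OF T, of verts] by simp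
  moreover have "parcs T = map_prod (iso_verts h) (iso_verts h) ` parcs S"
    using wf_digraph.arcs_ends_app_iso_eq[OF assms h, folded T]
    by (simp add: map_prod_def)
  ultimately show "\<exists>f. bij_betw f (pverts S) (pverts T) \<and> parcs T = map_prod f f ` parcs S"
    using h by (auto simp: bij_betw_def pre_digraph.digraph_isomorphism_def)
next
  assume "\<exists>f. bij_betw f (pverts S) (pverts T) \<and> parcs T = map_prod f f ` parcs S"
  then obtain f where f: "inj_on f (pverts S)" "pverts T = f ` pverts S"
    and T: "parcs T = map_prod f f ` parcs S"
    by (auto simp: bij_betw_def)
  let ?h = "\<lparr>iso_verts = f, iso_arcs = map_prod f f, iso_head = snd, iso_tail = fst\<rparr>"
  have "parcs S \<subseteq> pverts S \<times> pverts S"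
    using wf_digraph.tail_in_verts[OF assms] wf_digraph.head_in_verts[OF assms] by auto
  then have "inj_on (map_prod f f) (parcs S)"
    using map_prod_inj_on[OF f(1) f(1)] inj_on_subset by blast
  then have "pre_digraph.digraph_isomorphism (with_proj S) ?h"
    using f assms by (auto simp: pre_digraph.digraph_isomorphism_def)
  moreover have "with_proj T = app_iso ?h (with_proj S)"
    using f T by (simp add: app_iso_def with_proj_def)
  ultimately show "digraph_iso (with_proj S) (with_proj T)"
    by (auto simp: digraph_iso_def)
qed

lemma tournaments_wf: "T \<in> tournaments n \<Longrightarrow> wf_digraph (with_proj T)"
  by (auto simp: tournaments_def pair_tournament_def pair_loopfree_digraph_def
      wf_digraph_def pair_wf_digraph_def)

lemma equiv_tournament_iso: "equiv (tournaments n) (tournament_iso n)"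
proof (rule equivI)
  show "tournament_iso n \<subseteq> tournaments n \<times> tournaments n"
    by (auto simp: tournament_iso_def)
  have "digraph_iso (with_proj T) (with_proj T)" if "T \<in> tournaments n" for T
    unfolding digraph_iso_with_proj_iff[OF tournaments_wf[OF that]]
    by (rule exI[of _ id]) (simp add: prod.map_id0)
  then show "refl_on (tournaments n) (tournament_iso n)"
    by (auto simp: refl_on_def tournament_iso_def)
  show "sym (tournament_iso n)"
    by (auto simp: sym_def tournament_iso_def intro: digraph_iso_swap tournaments_wf)
  show "trans (tournament_iso n)"
    by (auto simp: trans_def tournament_iso_def intro: digraph_iso_trans)
qed

definition unordered_pairs :: "nat \<Rightarrow> nat set set" where
  "unordered_pairs n = {{u, v} | u v. u \<in> {1..n} \<and> v \<in> {1..n} \<and> u \<noteq> v}"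

text \<open>The permutation \<open>{u, v} \<mapsto> {g u, g v}\<close> of the unordered pairs, extended by the
  identity to all sets.\<close>

definition pair_perm :: "nat \<Rightarrow> (nat \<Rightarrow> nat) \<Rightarrow> (nat set \<Rightarrow> nat set)" where
  "pair_perm n g = perm_restrict (image g) (unordered_pairs n)"

lemma pair_perm_permutes:
  assumes "g permutes {1..n}"
  shows "pair_perm n g permutes unordered_pairs n"
proof (rule bij_imp_permutes)
  have inj: "inj g" using assms by (rule permutes_inj)
  have fin: "finite (unordered_pairs n)"
    by (rule finite_subset[of _ "Pow {1..n}"]) (auto simp: unordered_pairs_def)
  have "image g ` unordered_pairs n \<subseteq> unordered_pairs n"
  proof
    fix e assume "e \<in> image g ` unordered_pairs n"
    then obtain u v where uv: "u \<in> {1..n}" "v \<in> {1..n}" "u \<noteq> v" and e: "e = {g u, g v}"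
      by (auto simp: unordered_pairs_def)
    have "g u \<in> {1..n}" "g v \<in> {1..n}" "g u \<noteq> g v"
      using uv assms inj permutes_in_image[OF assms] by (blast, blast, auto dest: injD)
    then show "e \<in> unordered_pairs n" unfolding unordered_pairs_def e by blast
  qed
  moreover have "inj_on (image g) (unordered_pairs n)"
    using inj by (auto simp: inj_on_def inj_image_eq_iff)
  ultimately have "bij_betw (image g) (unordered_pairs n) (unordered_pairs n)"
    using fin by (simp add: bij_betw_def endo_inj_surj)
  then show "bij_betw (pair_perm n g) (unordered_pairs n) (unordered_pairs n)"
    by (subst bij_betw_cong[of _ _ "image g"]) (auto simp: pair_perm_def perm_restrict_def)
  show "pair_perm n g e = e" if "e \<notin> unordered_pairs n" for e
    using that by (simp add: pair_perm_def perm_restrict_def)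
qed

text \<open>Number of cycles of a permutation on \<open>A\<close>; fixed points in \<open>A\<close> are singleton cycles.\<close>

definition num_cycles :: "('a \<Rightarrow> 'a) \<Rightarrow> 'a set \<Rightarrow> nat" where
  "num_cycles f A = card {C. C \<subseteq> A \<and> cyclic_on f C}"

end

theory Submission
  imports Defs "HOL-Algebra.Group_Action"
begin

text \<open>By Burnside's lemma for the relabelling action of \<open>Sym(n)\<close>, it suffices to count the
  tournaments fixed by a permutation \<open>g\<close>. If \<open>g\<close> has even order, some power of \<open>g\<close> swaps two
  vertices, so no tournament is fixed. If \<open>g\<close> has odd order, no power of \<open>g\<close> swaps two vertices, so
  orienting one pair in each cycle of \<open>g\<^sub>E\<close> and spreading the choice along the cycles
  yields a fixed tournament \<open>R\<close>. The pairs on which another fixed tournament agrees with \<open>R\<close> form an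
  arbitrary union of cycles of \<open>g\<^sub>E\<close>, hence there are \<open>2 ^ c(g\<^sub>E)\<close> fixed tournaments.\<close>

section \<open>Invariant sets of a permutation\<close>

lemma bij_image_eq_iff:
  assumes "bij f"
  shows "f ` X = X \<longleftrightarrow> (\<forall>x. f x \<in> X \<longleftrightarrow> x \<in> X)"
proof
  assume "f ` X = X"
  then show "\<forall>x. f x \<in> X \<longleftrightarrow> x \<in> X"
    using bij_is_inj[OF assms] by (metis inj_image_mem_iff)
next
  assume *: "\<forall>x. f x \<in> X \<longleftrightarrow> x \<in> X"
  show "f ` X = X"
  proof
    show "f ` X \<subseteq> X" using * by auto
    show "X \<subseteq> f ` X"
    proof
      fix y assume "y \<in> X"
      moreover obtain x where "y = f x" using bij_is_surj[OF assms] by (metis surjD)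
      ultimately show "y \<in> f ` X" using * by auto
    qed
  qed
qed

lemma cyclic_on_disjoint:
  assumes "cyclic_on f C" "cyclic_on f D" "x \<in> C" "x \<in> D"
  shows "C = D"
  using assms by (metis orbit_cyclic_eq3)

text \<open>The image of a cycle is again cyclic and contains \<open>f x\<close> for any
  \<open>x\<close> in the cycle, so the two share a point and coincide.\<close>

lemma cyclic_on_image_eq:
  assumes "cyclic_on f C"
  shows "f ` C = C"
proof -
  have "cyclic_on f (f ` C)" using assms by (rule cyclic_on_image) simp
  moreover obtain x where "x \<in> C" using assms by (auto simp: cyclic_on_alldef)
  ultimately show ?thesis
    using assms cyclic_on_inI[OF assms] cyclic_on_disjoint by (metis imageI)
qed

text \<open>An invariant set contains the whole cycle of each of its points, so it is a union of
  cycles; as cycles are disjoint, the union determines which cycles were taken. Hence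
  \<open>Union\<close> is a bijection from the sets of cycles to the invariant subsets.\<close>

lemma card_invariant_subsets:
  assumes f: "f permutes S" and fin: "finite S"
  shows "card {X. X \<subseteq> S \<and> f ` X = X} = 2 ^ num_cycles f S"
proof -
  let ?C = "{C. C \<subseteq> S \<and> cyclic_on f C}"
  have "bij_betw Union (Pow ?C) {X. X \<subseteq> S \<and> f ` X = X}"
    unfolding bij_betw_def
  proof
    have sub: "A \<subseteq> B" if AB: "A \<subseteq> ?C" "B \<subseteq> ?C" "\<Union>A \<subseteq> \<Union>B" for A B
    proof
      fix C assume C: "C \<in> A"
      then have "cyclic_on f C" using AB by auto
      then obtain x where "x \<in> C" by (auto simp: cyclic_on_alldef)
      moreover from this obtain D where "D \<in> B" "x \<in> D" using AB C by auto
      moreover from this have "cyclic_on f D" using AB by auto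
      ultimately show "C \<in> B" using \<open>cyclic_on f C\<close> cyclic_on_disjoint by metis
    qed
    show "inj_on Union (Pow ?C)"
    proof (rule inj_onI)
      fix A B assume "A \<in> Pow ?C" "B \<in> Pow ?C" and eq: "\<Union>A = \<Union>B"
      then have "A \<subseteq> ?C" "B \<subseteq> ?C" by blast+
      then show "A = B" using sub[of A B] sub[of B A] unfolding eq by blast
    qed
    show "Union ` Pow ?C = {X. X \<subseteq> S \<and> f ` X = X}"
    proof (intro equalityI subsetI)
      fix X assume "X \<in> Union ` Pow ?C"
      then obtain A where "A \<subseteq> ?C" and X: "X = \<Union>A" by auto
      moreover from this have "\<And>C. C \<in> A \<Longrightarrow> f ` C = C"
        by (intro cyclic_on_image_eq) blast
      ultimately show "X \<in> {X. X \<subseteq> S \<and> f ` X = X}" by (auto simp: image_Union)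
    next
      fix X assume "X \<in> {X. X \<subseteq> S \<and> f ` X = X}"
      then have X: "X \<subseteq> S" "f ` X = X" by auto
      have orb: "Orbits.orbit f x \<subseteq> X" if "x \<in> X" for x
      proof
        fix y assume "y \<in> Orbits.orbit f x"
        then show "y \<in> X" by induct (use that X in auto)
      qed
      \<comment> \<open>\<open>Orbits.orbit f x\<close> collects the iterates from
        \<open>f x\<close> onwards, so \<open>x\<close> belongs to it only if \<open>f\<close>
        returns to \<open>x\<close>; finiteness of \<open>S\<close> guarantees this.\<close>
      have "permutation f" using f fin by (auto simp: permutation_permutes)
      then have "\<And>x. x \<in> Orbits.orbit f x" by (rule permutation_self_in_orbit)
      then have "X = \<Union>(Orbits.orbit f ` X)" using orb by blast
      moreover have "Orbits.orbit f ` X \<subseteq> ?C"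
        using orb X cyclic_on_orbit[OF f fin] by auto
      ultimately show "X \<in> Union ` Pow ?C" by blast
    qed
  qed
  then have "card {X. X \<subseteq> S \<and> f ` X = X} = card (Pow ?C)"
    by (simp add: bij_betw_same_card)
  also have "\<dots> = 2 ^ num_cycles f S"
    using fin by (simp add: num_cycles_def card_Pow)
  finally show ?thesis .
qed

section \<open>Powers of permutations swapping two points\<close>

lemma sym_group_pow: "g [^]\<^bsub>sym_group n\<^esub> (k::nat) = g ^^ k"
proof (induction k)
  case 0
  show ?case by (simp add: sym_group_one)
next
  case (Suc k)
  then show ?case by (simp add: sym_group_mult funpow_Suc_right del: funpow.simps)
qed

text \<open>If \<open>h = g ^^ k\<close> exchanges \<open>u\<close> and \<open>v\<close>, every even
  power of \<open>h\<close> fixes \<open>u\<close>. For \<open>ord g = 2 * j + 1\<close> also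
  \<open>h ^^ (2 * j + 1)\<close> is the identity, so
  \<open>u = h (h ^^ (2 * j)) u = h u = v\<close>, reading the middle term as \<open>h\<close>
  applied last.\<close>

lemma odd_ord_no_swap:
  assumes g: "g \<in> carrier (sym_group n)" and odd: "odd (group.ord (sym_group n) g)"
    and uv: "(g ^^ k) u = v" "(g ^^ k) v = u"
  shows "u = v"
proof -
  interpret group "sym_group n" by (rule sym_group_is_group)
  obtain j where j: "ord g = 2 * j + 1" using odd by (rule oddE)
  have "g ^^ ord g = id"
    using pow_ord_eq_1[OF g] by (simp add: sym_group_pow sym_group_one)
  then have "g ^^ (ord g * k) = id" by (simp flip: funpow_mult)
  then have "((g ^^ k) ^^ (2 * j + 1)) u = u" by (simp add: funpow_mult j mult.commute)
  moreover have "(((g ^^ k) ^^ 2) ^^ j) u = u"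
    by (induction j) (use uv in \<open>auto simp: eval_nat_numeral\<close>)
  then have "((g ^^ k) ^^ (2 * j)) u = u" by (simp add: funpow_mult ac_simps)
  ultimately show ?thesis using uv by simp
qed

text \<open>For \<open>ord g = 2 * k\<close> the power \<open>g ^^ k\<close> is an involution other
  than the identity; it exchanges any point that it moves with the image of that point.\<close>

lemma even_ord_swap:
  assumes g: "g \<in> carrier (sym_group n)" and even: "even (group.ord (sym_group n) g)"
  obtains k u v where "u \<in> {1..n}" "v \<in> {1..n}" "u \<noteq> v" "(g ^^ k) u = v" "(g ^^ k) v = u"
proof -
  interpret group "sym_group n" by (rule sym_group_is_group)
  have perm: "g permutes {1..n}" using g by (simp add: sym_group_carrier)
  obtain k where k: "ord g = 2 * k" using even by (rule evenE)
  have "finite (carrier (sym_group n))" by (simp add: sym_group_def finite_permutations)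
  \<comment> \<open>Order 0 would count as even with \<open>k = 0\<close>; once it is excluded,
    \<open>0 < k < ord g\<close>, and therefore \<open>g ^^ k\<close> is not the identity.\<close>
  then have "ord g \<ge> 1" using g by (rule ord_ge_1)
  then have "\<not> ord g dvd k" using k by (auto dest: dvd_imp_le)
  then have "g ^^ k \<noteq> id" using pow_eq_id[OF g] by (simp add: sym_group_pow sym_group_one)
  then obtain u where u: "(g ^^ k) u \<noteq> u" by (auto simp: fun_eq_iff)
  have pk: "g ^^ k permutes {1..n}" using perm by (rule permutes_funpow)
  have "u \<in> {1..n}" using u permutes_not_in[OF pk] by metis
  moreover from this have "(g ^^ k) u \<in> {1..n}" using permutes_in_image[OF pk] by blast
  moreover have "g ^^ ord g = id"
    using pow_ord_eq_1[OF g] by (simp add: sym_group_pow sym_group_one)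
  then have "(g ^^ k) ((g ^^ k) u) = u" by (simp add: k mult_2 funpow_add fun_eq_iff)
  ultimately show thesis using u that by metis
qed

section \<open>The action on tournaments\<close>

text \<open>The vertex set stays as it is because \<open>g\<close> will always permute it.\<close>

definition relabel :: "(nat \<Rightarrow> nat) \<Rightarrow> nat pair_pre_digraph \<Rightarrow> nat pair_pre_digraph" where
  "relabel g T = \<lparr>pverts = pverts T, parcs = map_prod g g ` parcs T\<rparr>"

lemma bij_map_prod:
  assumes "bij f" "bij g"
  shows "bij (map_prod f g)"
  using assms by (simp add: bij_def prod.inj_map map_prod_surj)

lemma relabel_eq_iff:
  assumes "bij g"
  shows "relabel g T = T \<longleftrightarrow> (\<forall>u v. (g u, g v) \<in> parcs T \<longleftrightarrow> (u, v) \<in> parcs T)"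
proof -
  have "relabel g T = T \<longleftrightarrow> map_prod g g ` parcs T = parcs T"
    by (cases T) (simp add: relabel_def)
  then show ?thesis
    using bij_image_eq_iff[OF bij_map_prod, of g g "parcs T"] assms by simp
qed

lemma relabel_comp: "relabel (g \<circ> h) T = relabel g (relabel h T)"
  unfolding relabel_def by (simp only: pair_pre_digraph.simps image_comp map_prod_compose)

lemma relabel_id [simp]: "relabel id T = T"
  by (simp add: relabel_def prod.map_id0)

lemma tournament_pverts: "T \<in> tournaments n \<Longrightarrow> pverts T = {1..n}"
  by (simp add: tournaments_def)

lemma tournament_arc_in:
  assumes "T \<in> tournaments n" "(u, v) \<in> parcs T"
  shows "u \<in> {1..n}" "v \<in> {1..n}" "u \<noteq> v"
proof -
  interpret pair_tournament T using assms by (simp add: tournaments_def)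
  show "u \<in> {1..n}" "v \<in> {1..n}" "u \<noteq> v"
    using assms(2) in_arcsD1 in_arcsD2 pair_no_loops tournament_pverts[OF assms(1)] by force+
qed

lemma tournament_arc_swap:
  assumes "T \<in> tournaments n" "u \<in> {1..n}" "v \<in> {1..n}" "u \<noteq> v"
  shows "(v, u) \<in> parcs T \<longleftrightarrow> (u, v) \<notin> parcs T"
proof -
  interpret pair_tournament T using assms by (simp add: tournaments_def)
  show ?thesis
    using exactly_one_arc[of v u] assms(2-4) unfolding tournament_pverts[OF assms(1)] by blast
qed

lemma tournamentsI:
  assumes "pverts T = {1..n}"
    and "\<And>u v. (u, v) \<in> parcs T \<Longrightarrow> u \<in> {1..n} \<and> v \<in> {1..n} \<and> u \<noteq> v"
    and "\<And>u v. \<lbrakk>u \<in> {1..n}; v \<in> {1..n}; u \<noteq> v\<rbrakk> \<Longrightarrow> (u, v) \<in> parcs T \<longleftrightarrow> (v, u) \<notin> parcs T"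
  shows "T \<in> tournaments n"
proof -
  have "pair_tournament T"
  proof
    fix e assume "e \<in> parcs T"
    then have "(fst e, snd e) \<in> parcs T" by simp
    then show "fst e \<in> pverts T" "snd e \<in> pverts T" "fst e \<noteq> snd e"
      using assms(1,2) by blast+
  next
    fix v w assume "v \<in> pverts T" "w \<in> pverts T" "v \<noteq> w"
    then show "(v, w) \<in> parcs T \<longleftrightarrow> (w, v) \<notin> parcs T"
      unfolding assms(1) by (rule assms(3))
  qed
  then show ?thesis using assms(1) by (simp add: tournaments_def)
qed

lemma finite_tournaments: "finite (tournaments n)"
proof (rule finite_subset)
  show "tournaments n \<subseteq> (\<lambda>A. \<lparr>pverts = {1..n}, parcs = A\<rparr>) ` Pow ({1..n} \<times> {1..n})"
  proof
    fix T assume "T \<in> tournaments n"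
    then have "parcs T \<in> Pow ({1..n} \<times> {1..n})"
      using tournament_arc_in(1,2) unfolding Pow_iff by (intro subrelI SigmaI)
    moreover have "T = \<lparr>pverts = {1..n}, parcs = parcs T\<rparr>"
      using \<open>T \<in> tournaments n\<close> by (simp add: tournament_pverts)
    ultimately show "T \<in> (\<lambda>A. \<lparr>pverts = {1..n}, parcs = A\<rparr>) ` Pow ({1..n} \<times> {1..n})" by blast
  qed
qed simp

lemma relabel_in_tournaments:
  assumes g: "g permutes {1..n}" and T: "T \<in> tournaments n"
  shows "relabel g T \<in> tournaments n"
proof -
  \<comment> \<open>Pulling arcs back along the inverse reduces the tournament conditions for the
    relabelled digraph to those for \<open>T\<close>.\<close>
  have arc: "(x, y) \<in> parcs (relabel g T) \<longleftrightarrow> (inv' g x, inv' g y) \<in> parcs T" for x y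
  proof -
    have "map_prod g g (inv' g x, inv' g y) \<in> map_prod g g ` parcs T \<longleftrightarrow>
        (inv' g x, inv' g y) \<in> parcs T"
      by (rule inj_image_mem_iff) (simp add: prod.inj_map permutes_inj[OF g])
    then show ?thesis by (simp add: relabel_def permutes_inverses[OF g])
  qed
  have "inv' g permutes {1..n}" using g by (rule permutes_inv)
  then have mem: "inv' g x \<in> {1..n} \<longleftrightarrow> x \<in> {1..n}" for x
    by (rule permutes_in_image)
  have inj: "inv' g x = inv' g y \<longleftrightarrow> x = y" for x y
    by (metis permutes_inverses(1)[OF g])
  show ?thesis
  proof (rule tournamentsI)
    show "pverts (relabel g T) = {1..n}" using T by (simp add: relabel_def tournament_pverts)
    show "u \<in> {1..n} \<and> v \<in> {1..n} \<and> u \<noteq> v" if "(u, v) \<in> parcs (relabel g T)" for u v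
      using that tournament_arc_in[OF T] mem inj unfolding arc by metis
    show "(u, v) \<in> parcs (relabel g T) \<longleftrightarrow> (v, u) \<notin> parcs (relabel g T)"
      if "u \<in> {1..n}" "v \<in> {1..n}" "u \<noteq> v" for u v
      unfolding arc by (rule tournament_arc_swap[OF T]) (use that mem inj in metis)+
  qed
qed

text \<open>The restriction is there because the elements of \<open>BijGroup\<close> are extensional
  functions.\<close>

abbreviation tournament_action where
  "tournament_action n g \<equiv> \<lambda>T\<in>tournaments n. relabel g T"

lemma tournament_group_action:
  "group_action (sym_group n) (tournaments n) (tournament_action n)"
proof -
  have Bij: "tournament_action n g \<in> Bij (tournaments n)" if "g permutes {1..n}" for g
  proof -
    have "bij_betw (tournament_action n g) (tournaments n) (tournaments n)"
    proof (rule bij_betw_byWitness[where f' = "relabel (inv' g)"])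
      show "\<forall>T\<in>tournaments n. relabel (inv' g) (tournament_action n g T) = T"
        using permutes_inv_o[OF that] by (simp flip: relabel_comp)
      show "\<forall>T\<in>tournaments n. tournament_action n g (relabel (inv' g) T) = T"
        using permutes_inv_o[OF that] permutes_inv[OF that]
        by (simp add: relabel_in_tournaments flip: relabel_comp)
    qed (use that in \<open>auto simp: relabel_in_tournaments permutes_inv\<close>)
    then show ?thesis by (simp add: Bij_def)
  qed
  have "tournament_action n \<in> hom (sym_group n) (BijGroup (tournaments n))"
  proof (rule homI)
    fix g h assume "g \<in> carrier (sym_group n)" "h \<in> carrier (sym_group n)"
    then have "g permutes {1..n}" "h permutes {1..n}" by (auto simp: sym_group_carrier)
    then show "tournament_action n (g \<otimes>\<^bsub>sym_group n\<^esub> h) =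
        tournament_action n g \<otimes>\<^bsub>BijGroup (tournaments n)\<^esub> tournament_action n h"
      using Bij
      by (auto simp: BijGroup_def sym_group_mult compose_def relabel_comp relabel_in_tournaments
          cong: restrict_cong)
  qed (use Bij in \<open>auto simp: BijGroup_def sym_group_carrier\<close>)
  then show ?thesis
    by (simp add: group_action_def group_hom_def group_hom_axioms_def sym_group_is_group
        group_BijGroup)
qed

lemma tournament_iso_iff:
  assumes S: "S \<in> tournaments n"
  shows "(S, T) \<in> tournament_iso n \<longleftrightarrow> (\<exists>g. g permutes {1..n} \<and> T = relabel g S)"
proof
  assume "(S, T) \<in> tournament_iso n"
  then have T: "T \<in> tournaments n" and iso: "digraph_iso (with_proj S) (with_proj T)"
    by (auto simp: tournament_iso_def)
  from iso obtain f where f: "bij_betw f (pverts S) (pverts T)"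
    and arcs: "parcs T = map_prod f f ` parcs S"
    unfolding digraph_iso_with_proj_iff[OF tournaments_wf[OF S]] by blast
  \<comment> \<open>The isomorphism \<open>f\<close> is arbitrary off the vertex set; extending by
    the identity makes it a permutation in the sense of \<open>permutes\<close> and changes no
    arc.\<close>
  define g where "g = (\<lambda>x. if x \<in> {1..n} then f x else x)"
  have "bij_betw f {1..n} {1..n}" using f S T by (simp add: tournament_pverts)
  then have "bij_betw g {1..n} {1..n}" by (subst bij_betw_cong[of _ _ f]) (auto simp: g_def)
  then have "g permutes {1..n}" by (rule bij_imp_permutes) (auto simp: g_def)
  moreover have "map_prod f f ` parcs S = map_prod g g ` parcs S"
    using tournament_arc_in(1,2)[OF S] by (intro image_cong) (auto simp: g_def)
  then have "T = relabel g S"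
    using S T arcs by (simp add: relabel_def tournament_pverts)
  ultimately show "\<exists>g. g permutes {1..n} \<and> T = relabel g S" by blast
next
  assume "\<exists>g. g permutes {1..n} \<and> T = relabel g S"
  then obtain g where g: "g permutes {1..n}" and T: "T = relabel g S" by blast
  have "bij_betw g (pverts S) (pverts T)" "parcs T = map_prod g g ` parcs S"
    using S permutes_imp_bij[OF g] by (simp_all add: T relabel_def tournament_pverts)
  then have "digraph_iso (with_proj S) (with_proj T)"
    unfolding digraph_iso_with_proj_iff[OF tournaments_wf[OF S]] by (intro exI conjI)
  then show "(S, T) \<in> tournament_iso n"
    using S relabel_in_tournaments[OF g S] by (simp add: tournament_iso_def T)
qed

text \<open>This brings the count of classes into the form to which Burnside's lemma
  applies.\<close>

lemma tournament_classes_eq_orbits: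
  "tournament_classes n = orbits (sym_group n) (tournaments n) (tournament_action n)"
proof -
  have "tournament_iso n `` {S} = Group_Action.orbit (sym_group n) (tournament_action n) S"
    if "S \<in> tournaments n" for S
    using that by (auto simp: Group_Action.orbit_def sym_group_carrier tournament_iso_iff)
  then show ?thesis
    by (auto simp: tournament_classes_def quotient_def orbits_def)
qed

section \<open>Tournaments fixed by a permutation\<close>

lemma in_unordered_pairs [simp]:
  "{u, v} \<in> unordered_pairs n \<longleftrightarrow> u \<in> {1..n} \<and> v \<in> {1..n} \<and> u \<noteq> v"
  by (auto simp: unordered_pairs_def doubleton_eq_iff)

text \<open>The guard remains a membership in \<open>unordered_pairs n\<close> so that it can
  discharge the premise of conditional rewrite rules for \<open>pair_perm\<close>.\<close>

lemma ball_unordered_pairs: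
  "(\<forall>e\<in>unordered_pairs n. P e) \<longleftrightarrow>
    (\<forall>u v. {u, v} \<in> unordered_pairs n \<longrightarrow> P {u, v})"
  unfolding in_unordered_pairs unfolding unordered_pairs_def by blast

lemma finite_unordered_pairs: "finite (unordered_pairs n)"
  by (rule finite_subset[of _ "Pow {1..n}"]) (auto simp: unordered_pairs_def)

text \<open>The iterates of \<open>e\<close> never leave the set of pairs, so the restriction in
  \<open>pair_perm\<close> has no effect along the way.\<close>

lemma pair_perm_funpow:
  assumes g: "g permutes {1..n}" and e: "e \<in> unordered_pairs n"
  shows "(pair_perm n g ^^ k) e = (g ^^ k) ` e"
proof (induction k)
  case (Suc k)
  have "(pair_perm n g ^^ k) e \<in> unordered_pairs n"
    using permutes_in_image[OF permutes_funpow[OF pair_perm_permutes[OF g]]] e by blast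
  then have "pair_perm n g ((pair_perm n g ^^ k) e) = g ` (pair_perm n g ^^ k) e"
    by (simp only: pair_perm_def perm_restrict_simps)
  then show ?case using Suc by (simp add: image_comp)
qed simp

lemma fixed_tournament_exists:
  assumes g: "g permutes {1..n}"
    and no_swap: "\<And>k u v. (g ^^ k) u = v \<Longrightarrow> (g ^^ k) v = u \<Longrightarrow> u = v"
  obtains R where "R \<in> tournaments n" "relabel g R = R"
proof -
  let ?f = "pair_perm n g"
  have f: "?f permutes unordered_pairs n" using g by (rule pair_perm_permutes)
  then have cyc: "cyclic_on ?f (Orbits.orbit ?f e)" for e
    using finite_unordered_pairs by (rule cyclic_on_orbit)
  have "permutation ?f"
    unfolding permutation_permutes using f finite_unordered_pairs by blast
  then have self: "e \<in> Orbits.orbit ?f e" for e by (rule permutation_self_in_orbit)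
  \<comment> \<open>\<open>rep C\<close> is an ordered pair whose underlying set lies in
    \<open>C\<close>. It depends only on the cycle, so \<open>{u, v}\<close> and
    \<open>{v, u}\<close> share it.\<close>
  define rep where "rep C = (SOME p. {fst p, snd p} \<in> C)" for C :: "nat set set"
  \<comment> \<open>The arcs of the fixed tournament: in each cycle, all images of the oriented
    representative under powers of \<open>g\<close>.\<close>
  define A where "A = {(u, v). u \<in> {1..n} \<and> v \<in> {1..n} \<and> u \<noteq> v \<and>
    (\<exists>k. (u, v) = map_prod (g ^^ k) (g ^^ k) (rep (Orbits.orbit ?f {u, v})))}"
  have orbit_image: "Orbits.orbit ?f {g u, g v} = Orbits.orbit ?f {u, v}"
    if "u \<in> {1..n}" "v \<in> {1..n}" "u \<noteq> v" for u v
  proof -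
    have "?f {u, v} = {g u, g v}" using that by (simp add: pair_perm_def perm_restrict_def)
    then have "{g u, g v} \<in> Orbits.orbit ?f {u, v}" by (metis orbit.base)
    then show ?thesis using cyc orbit_cyclic_eq3 by metis
  qed
  have mem: "g u \<in> {1..n} \<longleftrightarrow> u \<in> {1..n}" "g u = g v \<longleftrightarrow> u = v" for u v
    using permutes_in_image[OF g] permutes_inj[OF g] by (auto dest: injD)
  \<comment> \<open>Applying \<open>g\<close> raises the exponent \<open>k\<close> by one and stays
    in the same cycle of pairs, with the same representative. The inclusion becomes an equality
    because \<open>A\<close> is finite and \<open>g\<close> injective.\<close>
  have "map_prod g g ` A \<subseteq> A"
  proof (rule image_subsetI)
    fix p assume "p \<in> A"
    then obtain u v k where p: "p = (u, v)" and uv: "u \<in> {1..n}" "v \<in> {1..n}" "u \<noteq> v"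
      and k: "(u, v) = map_prod (g ^^ k) (g ^^ k) (rep (Orbits.orbit ?f {u, v}))"
      by (auto simp: A_def)
    have "(g u, g v) = map_prod (g ^^ Suc k) (g ^^ Suc k) (rep (Orbits.orbit ?f {g u, g v}))"
      unfolding orbit_image[OF uv] using k by (cases "rep (Orbits.orbit ?f {u, v})") simp
    then show "map_prod g g p \<in> A" using uv mem unfolding p A_def map_prod_simp by blast
  qed
  moreover have "finite A" by (rule finite_subset[of _ "{1..n} \<times> {1..n}"]) (auto simp: A_def)
  moreover have "inj_on (map_prod g g) A"
    using map_prod_inj_on[OF permutes_inj[OF g] permutes_inj[OF g]] by (auto intro: inj_on_subset)
  ultimately have inv: "map_prod g g ` A = A" by (simp add: endo_inj_surj)
  \<comment> \<open>Some power of the pair permutation carries the representative's pair to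
    \<open>{u, v}\<close>; the same power of \<open>g\<close> maps the ordered representative to
    \<open>(u, v)\<close> or to \<open>(v, u)\<close>.\<close>
  have some_arc: "(u, v) \<in> A \<or> (v, u) \<in> A" if uv: "u \<in> {1..n}" "v \<in> {1..n}" "u \<noteq> v" for u v
  proof -
    let ?C = "Orbits.orbit ?f {u, v}"
    obtain a b where ab: "rep ?C = (a, b)" by fastforce
    have "{fst (rep ?C), snd (rep ?C)} \<in> ?C"
      unfolding rep_def by (rule someI[of _ "(u, v)"]) (simp add: self)
    then have abC: "{a, b} \<in> ?C" by (simp add: ab)
    then have "{a, b} \<in> unordered_pairs n" using permutes_orbit_subset[OF f] uv
      by (meson in_unordered_pairs subsetD)
    moreover have "{u, v} \<in> Orbits.orbit ?f {a, b}"
      using abC self cyc orbit_cyclic_eq3 by metis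
    then obtain k where "{u, v} = (?f ^^ k) {a, b}" by (auto simp: orbit_altdef)
    ultimately have "{u, v} = {(g ^^ k) a, (g ^^ k) b}" using pair_perm_funpow[OF g] by simp
    then have "(u, v) = map_prod (g ^^ k) (g ^^ k) (rep ?C) \<or>
        (v, u) = map_prod (g ^^ k) (g ^^ k) (rep ?C)"
      by (auto simp: ab doubleton_eq_iff)
    then show ?thesis using uv insert_commute[of u v "{}"] unfolding A_def by auto
  qed
  \<comment> \<open>If \<open>(a, b)\<close> is sent to \<open>(u, v)\<close> by
    \<open>g ^^ k\<close> and to \<open>(v, u)\<close> by \<open>g ^^ l\<close>, then the power of
    \<open>g\<close> by the difference of \<open>k\<close> and \<open>l\<close> exchanges
    \<open>u\<close> and \<open>v\<close>, contrary to \<open>no_swap\<close>. Exponents are natural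
    numbers, hence the two cases.\<close>
  have one_arc: "\<not> ((u, v) \<in> A \<and> (v, u) \<in> A)" for u v
  proof
    assume asm: "(u, v) \<in> A \<and> (v, u) \<in> A"
    obtain a b where ab: "rep (Orbits.orbit ?f {u, v}) = (a, b)" by fastforce
    then have ba: "rep (Orbits.orbit ?f {v, u}) = (a, b)" by (simp add: insert_commute)
    have "u \<noteq> v" "\<exists>k. u = (g ^^ k) a \<and> v = (g ^^ k) b" "\<exists>l. v = (g ^^ l) a \<and> u = (g ^^ l) b"
      using asm unfolding A_def mem_Collect_eq prod.case ab ba map_prod_simp prod.inject by blast+
    then obtain k l where k: "u = (g ^^ k) a" "v = (g ^^ k) b"
      and l: "v = (g ^^ l) a" "u = (g ^^ l) b" by blast
    have split: "(g ^^ j) x = (g ^^ (j - i)) ((g ^^ i) x)" if "i \<le> j" for i j x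
      using that by (simp add: fun_cong[OF funpow_add, unfolded comp_apply, symmetric])
    show False
    proof (cases "k \<le> l")
      case True
      have "(g ^^ (l - k)) u = v"
        by (simp only: k(1) l(1) split[OF True, symmetric])
      moreover have "(g ^^ (l - k)) v = u"
        by (simp only: k(2) l(2) split[OF True, symmetric])
      ultimately show False using no_swap \<open>u \<noteq> v\<close> by blast
    next
      case False
      then have "l \<le> k" by simp
      have "(g ^^ (k - l)) u = v"
        by (simp only: l(2) k(2) split[OF \<open>l \<le> k\<close>, symmetric])
      moreover have "(g ^^ (k - l)) v = u"
        by (simp only: l(1) k(1) split[OF \<open>l \<le> k\<close>, symmetric])
      ultimately show False using no_swap \<open>u \<noteq> v\<close> by blast
    qed
  qed
  have "\<lparr>pverts = {1..n}, parcs = A\<rparr> \<in> tournaments n"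
    (is "?R \<in> _")
  proof (rule tournamentsI)
    show "u \<in> {1..n} \<and> v \<in> {1..n} \<and> u \<noteq> v" if "(u, v) \<in> parcs ?R" for u v
      using that by (simp add: A_def)
    show "(u, v) \<in> parcs ?R \<longleftrightarrow> (v, u) \<notin> parcs ?R"
      if "u \<in> {1..n}" "v \<in> {1..n}" "u \<noteq> v" for u v
      using some_arc[OF that] one_arc[of u v] by auto
  qed simp
  moreover have "relabel g \<lparr>pverts = {1..n}, parcs = A\<rparr> = \<lparr>pverts = {1..n}, parcs = A\<rparr>"
    by (simp add: relabel_def inv)
  ultimately show thesis by (rule that)
qed

lemma card_fixed_tournaments:
  assumes g: "g permutes {1..n}" and R: "R \<in> tournaments n" "relabel g R = R"
  shows "card {T \<in> tournaments n. relabel g T = T} =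
    2 ^ num_cycles (pair_perm n g) (unordered_pairs n)"
proof -
  let ?f = "pair_perm n g" and ?E = "unordered_pairs n"
  \<comment> \<open>\<open>flip X\<close> agrees with \<open>R\<close> on the pairs in
    \<open>X\<close> and reverses all others; in particular \<open>flip ?E\<close> has the arcs of
    \<open>R\<close>.\<close>
  define flip where "flip X = \<lparr>pverts = {1..n}, parcs = {(u, v). {u, v} \<in> ?E \<and>
    ((u, v) \<in> parcs R \<longleftrightarrow> {u, v} \<in> X)}\<rparr>" for X
  have bij: "bij g" and f: "?f permutes ?E"
    using g by (rule permutes_bij, rule pair_perm_permutes)
  have gE: "{g u, g v} \<in> ?E \<longleftrightarrow> {u, v} \<in> ?E" for u v
    unfolding in_unordered_pairs using permutes_in_image[OF g] permutes_inj[OF g]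
    by (auto dest: injD)
  have fE: "?f {u, v} = {g u, g v}" if "{u, v} \<in> ?E" for u v
    using that by (simp add: pair_perm_def perm_restrict_def)
  have Rg: "(g u, g v) \<in> parcs R \<longleftrightarrow> (u, v) \<in> parcs R" for u v
    using R(2) relabel_eq_iff[OF bij] by blast
  \<comment> \<open>As \<open>g\<close> preserves both \<open>?E\<close> and the arcs of
    \<open>R\<close>, invariance of \<open>flip X\<close> comes down to invariance of
    \<open>X\<close>.\<close>
  have flip_fixed: "relabel g (flip X) = flip X \<longleftrightarrow> ?f ` X = X" if X: "X \<subseteq> ?E" for X
  proof -
    have "relabel g (flip X) = flip X \<longleftrightarrow> (\<forall>u v. {u, v} \<in> ?E \<longrightarrow> ({g u, g v} \<in> X \<longleftrightarrow> {u, v} \<in> X))"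
      unfolding relabel_eq_iff[OF bij] flip_def
      by (simp only: pair_pre_digraph.simps mem_Collect_eq prod.case gE Rg) blast
    also have "\<dots> \<longleftrightarrow> (\<forall>e\<in>?E. ?f e \<in> X \<longleftrightarrow> e \<in> X)"
      by (simp only: ball_unordered_pairs fE cong: imp_cong)
    \<comment> \<open>Outside \<open>?E\<close> the permutation \<open>?f\<close> is the identity,
      so the unrestricted quantifier adds no condition.\<close>
    also have "\<dots> \<longleftrightarrow> (\<forall>e. ?f e \<in> X \<longleftrightarrow> e \<in> X)"
      using permutes_not_in[OF f] by metis
    finally show ?thesis using bij_image_eq_iff[OF permutes_bij[OF f]] by simp
  qed
  have R_arc: "(v, u) \<in> parcs R \<longleftrightarrow> (u, v) \<notin> parcs R" if "{u, v} \<in> ?E" for u v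
    using tournament_arc_swap[OF R(1), of u v] that unfolding in_unordered_pairs by blast
  have flip_tournament: "flip X \<in> tournaments n" for X
  proof (rule tournamentsI)
    show "pverts (flip X) = {1..n}" by (simp add: flip_def)
    show "u \<in> {1..n} \<and> v \<in> {1..n} \<and> u \<noteq> v" if "(u, v) \<in> parcs (flip X)" for u v
      using that by (simp add: flip_def)
    show "(u, v) \<in> parcs (flip X) \<longleftrightarrow> (v, u) \<notin> parcs (flip X)"
      if "u \<in> {1..n}" "v \<in> {1..n}" "u \<noteq> v" for u v
      using that R_arc[of u v] by (simp add: flip_def insert_commute[of v u])
  qed
  have inj: "inj_on flip {X. X \<subseteq> ?E}"
  proof (rule inj_onI)
    fix X Y assume XY: "X \<in> {X. X \<subseteq> ?E}" "Y \<in> {X. X \<subseteq> ?E}" and "flip X = flip Y"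
    then have eq: "parcs (flip X) = parcs (flip Y)" by simp
    have "{u, v} \<in> X \<longleftrightarrow> {u, v} \<in> Y" if "{u, v} \<in> ?E" for u v
      using eq that unfolding flip_def by auto
    then have "e \<in> X \<longleftrightarrow> e \<in> Y" if "e \<in> ?E" for e
      using that unfolding unordered_pairs_def by blast
    then show "X = Y" using XY by blast
  qed
  have surj: "T \<in> flip ` {X. X \<subseteq> ?E}" if T: "T \<in> tournaments n" for T
  proof
    \<comment> \<open>The pairs on which \<open>T\<close> and \<open>R\<close> agree. The order of
      \<open>u\<close> and \<open>v\<close> is immaterial: swapping them negates both arc
      conditions, by \<open>T_arc\<close> and \<open>R_arc\<close>.\<close>
    define X where "X = {{u, v} | u v. {u, v} \<in> ?E \<and> ((u, v) \<in> parcs R \<longleftrightarrow> (u, v) \<in> parcs T)}"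
    have T_arc: "(v, u) \<in> parcs T \<longleftrightarrow> (u, v) \<notin> parcs T" if "{u, v} \<in> ?E" for u v
      using tournament_arc_swap[OF T, of u v] that unfolding in_unordered_pairs by blast
    have "{u, v} \<in> X \<longleftrightarrow> ((u, v) \<in> parcs R \<longleftrightarrow> (u, v) \<in> parcs T)" if "{u, v} \<in> ?E" for u v
      using that T_arc[OF that] R_arc[OF that] by (auto simp: X_def doubleton_eq_iff)
    then have "(u, v) \<in> parcs (flip X) \<longleftrightarrow> (u, v) \<in> parcs T" for u v
      using tournament_arc_in[OF T, of u v] unfolding flip_def by auto
    then have "parcs (flip X) = parcs T" by auto
    moreover have "pverts (flip X) = pverts T" using T by (simp add: flip_def tournament_pverts)
    ultimately show "T = flip X" by simp
    show "X \<in> {X. X \<subseteq> ?E}" by (auto simp: X_def)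
  qed
  have "bij_betw flip {X. X \<subseteq> ?E \<and> ?f ` X = X} {T \<in> tournaments n. relabel g T = T}"
    unfolding bij_betw_def
  proof
    show "inj_on flip {X. X \<subseteq> ?E \<and> ?f ` X = X}"
      using inj by (rule inj_on_subset) blast
    show "flip ` {X. X \<subseteq> ?E \<and> ?f ` X = X} = {T \<in> tournaments n. relabel g T = T}"
    proof (intro equalityI subsetI)
      fix T assume "T \<in> {T \<in> tournaments n. relabel g T = T}"
      moreover from this obtain X where "X \<subseteq> ?E" "T = flip X" using surj by blast
      ultimately show "T \<in> flip ` {X. X \<subseteq> ?E \<and> ?f ` X = X}" using flip_fixed by blast
    qed (use flip_fixed flip_tournament in blast)
  qed
  then show ?thesis
    using card_invariant_subsets[OF f finite_unordered_pairs] by (simp add: bij_betw_same_card)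
qed

text \<open>An automorphism's power \<open>g ^^ k\<close> is again an automorphism, so exchanging
  \<open>u\<close> and \<open>v\<close> would force both or neither of the two arcs between
  them.\<close>

lemma swap_imp_no_fixed_tournament:
  assumes g: "g permutes {1..n}" and T: "T \<in> tournaments n"
    and uv: "u \<in> {1..n}" "v \<in> {1..n}" "u \<noteq> v" "(g ^^ k) u = v" "(g ^^ k) v = u"
  shows "relabel g T \<noteq> T"
proof
  assume "relabel g T = T"
  then have "(g u, g v) \<in> parcs T \<longleftrightarrow> (u, v) \<in> parcs T" for u v
    using relabel_eq_iff[OF permutes_bij[OF g]] by blast
  then have "((g ^^ k) u, (g ^^ k) v) \<in> parcs T \<longleftrightarrow> (u, v) \<in> parcs T" by (induction k) auto
  then show False using tournament_arc_swap[OF T uv(1-3)] unfolding uv(4,5) by blast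
qed

lemma card_invariants_tournament_action:
  assumes g: "g \<in> carrier (sym_group n)"
  shows "card (invariants (tournaments n) (tournament_action n) g) =
    (if odd (group.ord (sym_group n) g)
     then 2 ^ num_cycles (pair_perm n g) (unordered_pairs n) else 0)"
proof -
  have perm: "g permutes {1..n}" using g by (simp add: sym_group_carrier)
  have inv: "invariants (tournaments n) (tournament_action n) g =
      {T \<in> tournaments n. relabel g T = T}"
    by (auto simp: invariants_def)
  show ?thesis
  proof (cases "odd (group.ord (sym_group n) g)")
    case True
    then obtain R where "R \<in> tournaments n" "relabel g R = R"
      using fixed_tournament_exists[OF perm] odd_ord_no_swap[OF g] by metis
    then show ?thesis using True card_fixed_tournaments[OF perm] by (simp add: inv)
  next
    case False
    then obtain k u v where "u \<in> {1..n}" "v \<in> {1..n}" "u \<noteq> v" "(g ^^ k) u = v" "(g ^^ k) v = u"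
      using even_ord_swap[OF g] by metis
    then have empty: "{T \<in> tournaments n. relabel g T = T} = {}"
      using swap_imp_no_fixed_tournament[OF perm] by blast
    show ?thesis using False unfolding inv empty by simp
  qed
qed

theorem theorem3p3:
  fixes n :: nat
  assumes "n > 0"
  shows "real (card (tournament_classes n)) =
    (1 / fact n) * (\<Sum>g | g \<in> carrier (sym_group n) \<and> odd (group.ord (sym_group n) g).
      2 ^ num_cycles (pair_perm n g) (unordered_pairs n))"
proof -
  let ?G = "sym_group n"
  have fin: "finite (carrier ?G)" by (simp add: sym_group_def finite_permutations)
  have order: "order ?G = fact n"
    using card_permutations[of "{1..n}" n] by (simp add: order_def sym_group_def)
  \<comment> \<open>Burnside's lemma in product form keeps the computation in the natural numbers;
    the division by \<open>fact n\<close> takes place only at the end, in the reals.\<close>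
  have "card (tournament_classes n) * order ?G =
      (\<Sum>g\<in>carrier ?G. card (invariants (tournaments n) (tournament_action n) g))"
    unfolding tournament_classes_eq_orbits
    using group_action.burnside[OF tournament_group_action fin finite_tournaments] .
  also have "\<dots> = (\<Sum>g\<in>carrier ?G. if odd (group.ord ?G g)
      then 2 ^ num_cycles (pair_perm n g) (unordered_pairs n) else 0)"
    by (intro sum.cong card_invariants_tournament_action refl)
  also have "\<dots> = (\<Sum>g | g \<in> carrier ?G \<and> odd (group.ord ?G g).
      2 ^ num_cycles (pair_perm n g) (unordered_pairs n))"
    using fin by (simp only: sum.inter_filter)
  finally have "real (card (tournament_classes n) * fact n) =
      real (\<Sum>g | g \<in> carrier ?G \<and> odd (group.ord ?G g).
        2 ^ num_cycles (pair_perm n g) (unordered_pairs n))"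
    by (simp only: order)
  then show ?thesis by (simp add: field_simps)
qed

end
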